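(* Let $N\ge 2$ and let $\{g_i\}_{i\in\mathcal I_N}$ be an LF system normalized by $d_i=1$, with associated probability vectors $\mathfrak p_i\in\overline{\mathcal P_N}$, $i\in\mathcal I_N$. If the set $\{\mathfrak p_i : i\in\mathcal I_N\}$ has exactly one element (that is, $\mathfrak p_0=\dots=\mathfrak p_{N-1}$), then for every $\epsilon\in(0,1/2)$ there exists $\delta>0$ such that the following holds: for every contractive system $\{f_i\}_{i\in\mathcal I_N}$ on $[0,1]$ such that, with $r_i:=\|f_i\|_{\mathrm{Lip}}$ and $\mathbf r:=(r_0,\dots,r_{N-1})$, $\sum_{i\in\mathcal I_N} r_i<1+\delta$, $\epsilon\le r_i\le 1-\epsilon$ for each $i\in\mathcal I_N$, and $\|\mathbf r-\mathfrak p_0\|_1\ge\epsilon$, one has $\dim_H\mu_\varphi<1$, where $\varphi$ is the unique continuous strictly increasing solution $\varphi:[0,1]\to[0,1]$ of $g_i\circ\varphi=\varphi\circ f_i$ ($i\in\mathcal I_N$) and $\mu_\varphi$ is the Borel probability measure on $[0,1]$ with distribution function $\varphi$.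
   Context: Let $N\ge2$ and $\mathcal I_N=\{0,1,\dots,N-1\}$. For vectors $\mathbf p,\mathbf q\in\mathbb R^N$, $\|\mathbf p-\mathbf q\|_1=\sum_{i\in\mathcal I_N}|p_i-q_i|$. A compatible system on $[0,1]$ is a family $\{h_i\}_{i\in\mathcal I_N}$ of strictly increasing continuous functions $h_i:[0,1]\to[0,1]$ with $h_0(0)=0$, $h_{i-1}(1)=h_i(0)$ for $1\le i\le N-1$, and $h_{N-1}(1)=1$. For $h:[0,1]\to[0,1]$, $\|h\|_{\mathrm{Lip}}:=\sup_{x\ne y}|h(x)-h(y)|/|x-y|$; $h$ is a contraction if $\|h\|_{\mathrm{Lip}}<1$. A contractive system on $[0,1]$ is a compatible system all of whose members are contractions. An LF system normalized by $d_i=1$ is a family $g_i(x)=\frac{a_ix+b_i}{c_ix+1}$, $x\in[0,1]$, $i\in\mathcal I_N$, with real numbers $a_i,b_i,c_i$ such that, for all $i\in\mathcal I_N$: (1) $c_i+1>0$; (2) $0<a_i-b_ic_i\le\min\{1,(c_i+1)^2\}$; (3) $b_0=0$ and $\frac{a_i+b_i}{c_i+1}=b_{i+1}$, where $b_N:=1$. (These imply $0=b_0<b_1<\dots<b_N=1$, $0<a_0\le1$ and $(1-a_i)^2+4b_ic_i\ge0$.) For $\{f_i\}$ a contractive system and $\{g_i\}$ an LF system, the equation $g_i\circ\varphi=\varphi\circ f_i$ $(i\in\mathcal I_N)$ has a unique continuous strictly increasing solution $\varphi:[0,1]\to[0,1]$. From $\{g_i\}$ define: $\alpha$ is the minimum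 and $\beta$ the maximum of the numbers $0$, $\frac{c_0}{1-a_0}$, and $\frac{a_i-1+\sqrt{(1-a_i)^2+4b_ic_i}}{2b_i}$ $(1\le i\le N-1)$, where, if $a_0=1$, the number $\frac{c_0}{1-a_0}$ is omitted in the definition of $\alpha$ and is taken to be $+\infty$ in the definition of $\beta$. Then $Y:=[\alpha,\beta]\subset[-1,+\infty]$ (with $+\infty$ added as compactification point if $\beta=+\infty$). For $y\in Y$ and $i\in\mathcal I_N$ put $$G_i(y)=\frac{(b_{i+1}-b_i)(y+1)}{(b_{i+1}y+1)(b_iy+1)},\qquad H_i(y)=\frac{a_iy+c_i}{b_iy+1},$$ where for $i=N-1$ the first expression is understood in the simplified form $G_{N-1}(y)=\frac{1-b_{N-1}}{b_{N-1}y+1}$, and $G_0(+\infty)=1$, $G_i(+\infty)=0$ $(i\ge1)$, $H_0(+\infty)=+\infty$, $H_i(+\infty)=a_i/b_i$ $(i\ge1)$. Then $G_i:Y\to[0,1]$ and $H_i:Y\to Y$ are continuous and $\sum_iG_i(y)=1$. Each $H_i$ has exactly one fixed point in $Y$, denoted $\mathrm{Fix}(H_i)$: it is $\frac{c_0}{1-a_0}$ for $i=0$ ($+\infty$ if $a_0=1$) and $\frac{a_i-1+\sqrt{(1-a_i)^2+4b_ic_i}}{2b_i}$ for $i\ge1$. $\overline{\mathcal P_N}=\{(p_i)_{i\in\mathcal I_N}:p_i\ge0,\sum_ip_i=1\}$, $\mathbf G(y)=(G_0(y),\dots,G_{N-1}(y))\in\overline{\mathcal P_N}$, and $\mathfrak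 p_i:=\mathbf G(\mathrm{Fix}(H_i))$. For a Borel probability measure $\mu$ on $[0,1]$, $\dim_H\mu:=\inf\{\dim_HA: A\subset[0,1]\text{ Borel},\ \mu(A)=1\}$, where $\dim_H A$ is Hausdorff dimension. *)

theory Defs
  imports "HOL-Probability.Probability"
begin

section \<open>Compatible and contractive systems on the unit interval\<close>

text \<open>Families indexed by $\{0,\dots,N-1\}$ are functions on \<^typ>\<open>nat\<close> of which only the values
  below \<open>N\<close> matter, and maps of $[0,1]$ are total functions on \<^typ>\<open>real\<close> of which only the
  values on $[0,1]$ matter.\<close>

definition compatible_system :: "nat \<Rightarrow> (nat \<Rightarrow> real \<Rightarrow> real) \<Rightarrow> bool" where
  "compatible_system N h \<longleftrightarrow>
     (\<forall>i<N. h i \<in> {0..1} \<rightarrow> {0..1} \<and> strict_mono_on {0..1} (h i) \<and> continuous_on {0..1} (h i)) \<and>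
     h 0 0 = 0 \<and> (\<forall>i\<in>{1..N - 1}. h (i - 1) 1 = h i 0) \<and> h (N - 1) 1 = 1"

text \<open>The supremum is taken in \<^typ>\<open>ereal\<close>, so that it is \<open>\<infinity>\<close> for a function that is not
  Lipschitz.\<close>

definition lip_norm :: "(real \<Rightarrow> real) \<Rightarrow> ereal" where
  "lip_norm h =
     (SUP (x, y) \<in> {(x, y). x \<in> {0..1} \<and> y \<in> {0..1} \<and> x \<noteq> y}. ereal (\<bar>h x - h y\<bar> / \<bar>x - y\<bar>))"

definition contraction :: "(real \<Rightarrow> real) \<Rightarrow> bool" where
  "contraction h \<longleftrightarrow> lip_norm h < 1"

definition contractive_system :: "nat \<Rightarrow> (nat \<Rightarrow> real \<Rightarrow> real) \<Rightarrow> bool" where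
  "contractive_system N f \<longleftrightarrow> compatible_system N f \<and> (\<forall>i<N. contraction (f i))"

text \<open>The real number \<open>lip_const h\<close> is \<open>lip_norm h\<close> whenever the latter is finite, in particular
  for the members of a contractive system.\<close>

definition lip_const :: "(real \<Rightarrow> real) \<Rightarrow> real" where
  "lip_const h = real_of_ereal (lip_norm h)"


section \<open>LF systems normalized by $d_i = 1$\<close>

definition lf_map :: "(nat \<Rightarrow> real) \<Rightarrow> (nat \<Rightarrow> real) \<Rightarrow> (nat \<Rightarrow> real) \<Rightarrow> nat \<Rightarrow> real \<Rightarrow> real" where
  "lf_map a b c i x = (a i * x + b i) / (c i * x + 1)"

text \<open>The value \<open>b N\<close> is not a coefficient of the system; \<open>b N = 1\<close> is the convention $b_N := 1$.\<close>

definition lf_system :: "nat \<Rightarrow> (nat \<Rightarrow> real) \<Rightarrow> (nat \<Rightarrow> real) \<Rightarrow> (nat \<Rightarrow> real) \<Rightarrow> bool" where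
  "lf_system N a b c \<longleftrightarrow>
     b N = 1 \<and> b 0 = 0 \<and>
     (\<forall>i<N. c i + 1 > 0 \<and>
            0 < a i - b i * c i \<and> a i - b i * c i \<le> min 1 ((c i + 1)\<^sup>2) \<and>
            (a i + b i) / (c i + 1) = b (i + 1))"

definition lf_root :: "(nat \<Rightarrow> real) \<Rightarrow> (nat \<Rightarrow> real) \<Rightarrow> (nat \<Rightarrow> real) \<Rightarrow> nat \<Rightarrow> real" where
  "lf_root a b c i = (a i - 1 + sqrt ((1 - a i)\<^sup>2 + 4 * b i * c i)) / (2 * b i)"

definition lf_alpha :: "nat \<Rightarrow> (nat \<Rightarrow> real) \<Rightarrow> (nat \<Rightarrow> real) \<Rightarrow> (nat \<Rightarrow> real) \<Rightarrow> real" where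
  "lf_alpha N a b c =
     Min ({0} \<union> (if a 0 = 1 then {} else {c 0 / (1 - a 0)}) \<union> lf_root a b c ` {1..N - 1})"

definition lf_beta :: "nat \<Rightarrow> (nat \<Rightarrow> real) \<Rightarrow> (nat \<Rightarrow> real) \<Rightarrow> (nat \<Rightarrow> real) \<Rightarrow> ereal" where
  "lf_beta N a b c =
     Max ({0} \<union> {if a 0 = 1 then \<infinity> else ereal (c 0 / (1 - a 0))} \<union>
          (\<lambda>i. ereal (lf_root a b c i)) ` {1..N - 1})"

definition lf_Y :: "nat \<Rightarrow> (nat \<Rightarrow> real) \<Rightarrow> (nat \<Rightarrow> real) \<Rightarrow> (nat \<Rightarrow> real) \<Rightarrow> ereal set" where
  "lf_Y N a b c = {ereal (lf_alpha N a b c)..lf_beta N a b c}"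

text \<open>For \<open>i = N - 1\<close> the factor \<open>y + 1\<close> is cancelled against \<open>b N * y + 1\<close>, which matters
  only at \<open>y = -1\<close>.\<close>

definition lf_G :: "nat \<Rightarrow> (nat \<Rightarrow> real) \<Rightarrow> nat \<Rightarrow> ereal \<Rightarrow> real" where
  "lf_G N b i y =
     (if y = \<infinity> then (if i = 0 then 1 else 0)
      else let t = real_of_ereal y in
        if i = N - 1 then (1 - b (N - 1)) / (b (N - 1) * t + 1)
        else (b (i + 1) - b i) * (t + 1) / ((b (i + 1) * t + 1) * (b i * t + 1)))"

definition lf_H :: "(nat \<Rightarrow> real) \<Rightarrow> (nat \<Rightarrow> real) \<Rightarrow> (nat \<Rightarrow> real) \<Rightarrow> nat \<Rightarrow> ereal \<Rightarrow> ereal" where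
  "lf_H a b c i y =
     (if y = \<infinity> then (if i = 0 then \<infinity> else ereal (a i / b i))
      else let t = real_of_ereal y in ereal ((a i * t + c i) / (b i * t + 1)))"

text \<open>Existence and uniqueness of the fixed point, and its explicit value, are the lemmas
  \<open>lf_fixpoint_in_Y\<close>, \<open>lf_H_fixed_iff\<close> and
  \<open>lf_Fix_eq\<close> below.\<close>

definition lf_Fix :: "nat \<Rightarrow> (nat \<Rightarrow> real) \<Rightarrow> (nat \<Rightarrow> real) \<Rightarrow> (nat \<Rightarrow> real) \<Rightarrow> nat \<Rightarrow> ereal" where
  "lf_Fix N a b c i = (THE y. y \<in> lf_Y N a b c \<and> lf_H a b c i y = y)"

text \<open>The vector $\mathbf G(\mathrm{Fix}(H_i))$. It is \<open>undefined\<close> outside the index set, so that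
  equality of two such vectors is equality of their \<open>N\<close> coordinates.\<close>

definition lf_prob ::
  "nat \<Rightarrow> (nat \<Rightarrow> real) \<Rightarrow> (nat \<Rightarrow> real) \<Rightarrow> (nat \<Rightarrow> real) \<Rightarrow> nat \<Rightarrow> (nat \<Rightarrow> real)" where
  "lf_prob N a b c i = (\<lambda>j\<in>{..<N}. lf_G N b j (lf_Fix N a b c i))"


section \<open>The functional equation and the measure\<close>

definition conjugacy_solution ::
  "nat \<Rightarrow> (nat \<Rightarrow> real \<Rightarrow> real) \<Rightarrow> (nat \<Rightarrow> real \<Rightarrow> real) \<Rightarrow> (real \<Rightarrow> real) \<Rightarrow> bool" where
  "conjugacy_solution N f g \<phi> \<longleftrightarrow>
     \<phi> \<in> {0..1} \<rightarrow> {0..1} \<and> continuous_on {0..1} \<phi> \<and> strict_mono_on {0..1} \<phi> \<and>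
     (\<forall>i<N. \<forall>x\<in>{0..1}. g i (\<phi> x) = \<phi> (f i x))"

text \<open>The Borel probability measure on $[0,1]$ with distribution function \<open>\<phi>\<close>
  (see \<open>dist_measure_characterization\<close>).\<close>

definition dist_measure :: "(real \<Rightarrow> real) \<Rightarrow> real measure" where
  "dist_measure \<phi> =
     restrict_space
       (interval_measure (\<lambda>x. if x < 0 then 0 else if x \<le> 1 then \<phi> x else 1)) {0..1}"


section \<open>Hausdorff dimension\<close>

text \<open>$(\mathrm{diam}\,U)^s$ with the usual conventions for \<open>s = 0\<close> (recall that
  \<open>0 powr 0 = 0\<close>).\<close>

definition hausdorff_gauge :: "real \<Rightarrow> 'a::metric_space set \<Rightarrow> ennreal" where
  "hausdorff_gauge s U =
     (if U = {} then 0 else if s = 0 then 1 else ennreal (diameter U powr s))"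

text \<open>The covering sets are required to be bounded because \<^const>\<open>diameter\<close> is meaningless on
  unbounded sets.\<close>

definition hausdorff_premeasure :: "real \<Rightarrow> real \<Rightarrow> 'a::metric_space set \<Rightarrow> ennreal" where
  "hausdorff_premeasure s \<rho> A =
     (INF U \<in> {U :: nat \<Rightarrow> 'a set. A \<subseteq> (\<Union>n. U n) \<and> (\<forall>n. bounded (U n) \<and> diameter (U n) \<le> \<rho>)}.
        \<Sum>n. hausdorff_gauge s (U n))"

definition hausdorff_measure :: "real \<Rightarrow> 'a::metric_space set \<Rightarrow> ennreal" where
  "hausdorff_measure s A = (SUP \<rho> \<in> {0<..}. hausdorff_premeasure s \<rho> A)"

definition hausdorff_dim :: "'a::metric_space set \<Rightarrow> ennreal" where
  "hausdorff_dim A = (INF s \<in> {s. 0 \<le> s \<and> hausdorff_measure s A = 0}. ennreal s)"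

definition measure_hausdorff_dim :: "real measure \<Rightarrow> ennreal" where
  "measure_hausdorff_dim \<mu> =
     (INF A \<in> {A. A \<in> sets borel \<and> A \<subseteq> {0..1} \<and> emeasure \<mu> A = 1}. hausdorff_dim A)"


section \<open>Well-definedness\<close>

lemma lf_systemD:
  assumes "lf_system N a b c" "i < N"
  shows "c i + 1 > 0" "0 < a i - b i * c i" "a i - b i * c i \<le> 1"
    "a i - b i * c i \<le> (c i + 1)\<^sup>2" "a i + b i = b (Suc i) * (c i + 1)"
  using assms by (auto simp: lf_system_def divide_simps)

lemma lf_b_less:
  assumes "lf_system N a b c" "i < N"
  shows "b i < b (Suc i)"
proof -
  note d = lf_systemD[OF assms]
  have "b i * (c i + 1) < b (Suc i) * (c i + 1)"
    using d(2,5) by (simp add: algebra_simps)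
  thus ?thesis using d(1) by simp
qed

lemma lf_b_mono:
  assumes "lf_system N a b c" "i < j" "j \<le> N"
  shows "b i < b j"
  using assms(2,3)
proof (induction j)
  case (Suc j)
  have "b j < b (Suc j)" using lf_b_less[OF assms(1), of j] Suc.prems by simp
  thus ?case using Suc by (cases "i = j") auto
qed simp

lemma lf_b_bounds:
  assumes "lf_system N a b c" "i < N" "0 < i"
  shows "0 < b i" "b i < 1"
  using lf_b_mono[OF assms(1), of 0 i] lf_b_mono[OF assms(1), of i N] assms
  by (auto simp: lf_system_def)

lemma lf_zero_less:
  assumes "lf_system N a b c" "N \<ge> 2"
  shows "0 < a 0" "a 0 \<le> 1" "a 0 < c 0 + 1" "a 0 = 1 \<Longrightarrow> 0 < c 0"
proof -
  have b0: "b 0 = 0" using assms by (simp add: lf_system_def)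
  note d = lf_systemD[OF assms(1), of 0]
  show "0 < a 0" "a 0 \<le> 1" using d assms b0 by auto
  have "b 1 < 1" using lf_b_bounds[OF assms(1), of 1] assms by auto
  hence "b 1 * (c 0 + 1) < 1 * (c 0 + 1)" using d(1) assms by (intro mult_strict_right_mono) auto
  thus "a 0 < c 0 + 1" using d(5) assms b0 by simp
  thus "a 0 = 1 \<Longrightarrow> 0 < c 0" by simp
qed

text \<open>Position of the roots of $b_i y^2 + (1-a_i) y - c_i$, the fixed point equation of $H_i$,
  relative to $-1$.\<close>

lemma lf_root_props:
  assumes "lf_system N a b c" "N \<ge> 2" "i < N" "0 < i"
  shows "b i * (lf_root a b c i)\<^sup>2 + (1 - a i) * lf_root a b c i - c i = 0" (is ?A)
    and "b i * y\<^sup>2 + (1 - a i) * y - c i = 0 \<Longrightarrow> y = lf_root a b c i \<or> y < -1 \<or> (i = N - 1 \<and> y = -1)"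
    and "-1 \<le> lf_root a b c i" "i < N - 1 \<Longrightarrow> -1 < lf_root a b c i"
proof -
  note d = lf_systemD[OF assms(1,3)]
  note bb = lf_b_bounds[OF assms(1,3,4)]
  define B A C r where "B = b i" and "A = a i" and "C = c i" and "r = lf_root a b c i"
  define D where "D = (1 - A)\<^sup>2 + 4 * B * C"
  define s where "s = (A - 1 - sqrt D) / (2 * B)"
  have B: "0 < B" "B < 1" using bb by (auto simp: B_def)
  have le1: "b (Suc i) \<le> 1"
    using lf_b_mono[OF assms(1), of "Suc i" N] assms by (cases "Suc i = N") (auto simp: lf_system_def)
  have q1: "B - 1 + A - C = (b (Suc i) - 1) * (C + 1)"
    using d(5) by (simp add: A_def B_def C_def algebra_simps)
  have q1_le: "B - 1 + A - C \<le> 0"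
    unfolding q1 using le1 d(1) by (intro mult_nonpos_nonneg) (auto simp: C_def)
  have D_eq: "D = (2 * B - (1 - A))\<^sup>2 - 4 * B * (B - 1 + A - C)"
    by (simp add: D_def power2_eq_square algebra_simps)
  have D_ge: "(2 * B - (1 - A))\<^sup>2 \<le> D"
    unfolding D_eq using B q1_le by (simp add: mult_nonneg_nonpos)
  have D0: "0 \<le> D" using D_ge by (rule order_trans[OF zero_le_power2])
  have r: "r = (A - 1 + sqrt D) / (2 * B)"
    by (simp add: r_def lf_root_def D_def A_def B_def C_def)
  have sq: "sqrt D * sqrt D = (1 - A)\<^sup>2 + 4 * B * C" using D0 by (simp add: D_def)
  have sum: "B * (r + s) = A - 1" using B by (simp add: r s_def field_simps)
  have pr: "B * (r * s) = - C"
  proof -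
    have "B * (r * s) = ((A - 1)\<^sup>2 - sqrt D * sqrt D) / (4 * B)"
      using B by (simp add: r s_def field_simps power2_eq_square)
    also have "\<dots> = - C" unfolding sq using B by (simp add: field_simps power2_eq_square)
    finally show ?thesis .
  qed
  have fact: "B * y\<^sup>2 + (1 - A) * y - C = B * (y - r) * (y - s)" for y
  proof -
    have "B * (y - r) * (y - s) = B * y\<^sup>2 - (B * (r + s)) * y + B * (r * s)"
      by (simp add: algebra_simps power2_eq_square)
    thus ?thesis unfolding sum pr by (simp add: algebra_simps)
  qed
  show ?A using fact[of r] by (simp add: A_def B_def C_def r_def)
  have sD: "\<bar>2 * B - (1 - A)\<bar> \<le> sqrt D" using D_ge by (intro real_le_rsqrt) simp
  have r_ge: "-1 \<le> r" and s_le: "s \<le> -1"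
    using B sD by (simp_all add: r s_def field_simps)
  show "-1 \<le> lf_root a b c i" using r_ge by (simp add: r_def)
  have strict: "-1 < r \<and> s < -1" if "i < N - 1"
  proof -
    have "b (Suc i) < 1"
      using lf_b_mono[OF assms(1), of "Suc i" N] that assms(1) by (auto simp: lf_system_def)
    hence "B - 1 + A - C < 0" unfolding q1 using d(1) by (intro mult_neg_pos) (auto simp: C_def)
    hence "B * (-1 - r) * (-1 - s) < 0" using fact[of "-1"] by simp
    hence "-1 \<noteq> r" "-1 \<noteq> s" by auto
    thus ?thesis using r_ge s_le by auto
  qed
  show "i < N - 1 \<Longrightarrow> -1 < lf_root a b c i" using strict by (simp add: r_def)
  assume "b i * y\<^sup>2 + (1 - a i) * y - c i = 0"
  hence "y = r \<or> y = s" using fact[of y] B by (simp add: A_def B_def C_def)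
  thus "y = lf_root a b c i \<or> y < -1 \<or> (i = N - 1 \<and> y = -1)"
    using s_le strict assms(3) unfolding r_def
    by (metis One_nat_def Suc_pred assms(4) le_neq_implies_less less_Suc_eq less_or_eq_imp_le
        order.strict_trans1 order_less_le)
qed


definition lf_fixpoint :: "(nat \<Rightarrow> real) \<Rightarrow> (nat \<Rightarrow> real) \<Rightarrow> (nat \<Rightarrow> real) \<Rightarrow> nat \<Rightarrow> ereal" where
  "lf_fixpoint a b c i =
     (if i = 0 then (if a 0 = 1 then \<infinity> else ereal (c 0 / (1 - a 0))) else ereal (lf_root a b c i))"

lemma lf_first_fix_gt:
  assumes "lf_system N a b c" "N \<ge> 2" "a 0 \<noteq> 1"
  shows "-1 < c 0 / (1 - a 0)"
  using lf_zero_less[OF assms(1,2)] assms(3) by (simp add: field_simps)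

lemma lf_alpha_bounds:
  assumes "lf_system N a b c" "N \<ge> 2"
  shows "-1 \<le> lf_alpha N a b c" "lf_alpha N a b c \<le> 0"
    "lf_alpha N a b c = -1 \<Longrightarrow> lf_root a b c (N - 1) = -1"
proof -
  let ?S = "{0} \<union> (if a 0 = 1 then {} else {c 0 / (1 - a 0)}) \<union> lf_root a b c ` {1..N - 1}"
  have fin: "finite ?S" by simp
  have root: "-1 \<le> lf_root a b c i" if "i \<in> {1..N - 1}" for i
    using lf_root_props(3)[OF assms, of i] that assms(2) by auto
  have first: "-1 < c 0 / (1 - a 0)" if "a 0 \<noteq> 1" using lf_first_fix_gt[OF assms that] .
  show "-1 \<le> lf_alpha N a b c"
    unfolding lf_alpha_def using fin root first by (subst Min_ge_iff) (auto split: if_splits)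
  show "lf_alpha N a b c \<le> 0" unfolding lf_alpha_def using fin by (intro Min_le) auto
  assume "lf_alpha N a b c = -1"
  moreover have "lf_alpha N a b c \<in> ?S" unfolding lf_alpha_def using fin by (intro Min_in) auto
  ultimately have "-1 \<in> ?S" by simp
  then obtain i where i: "i \<in> {1..N - 1}" "lf_root a b c i = -1"
    using first by (auto split: if_splits)
  have "i < N" using i(1) assms(2) by auto
  hence "\<not> i < N - 1" using lf_root_props(4)[OF assms, of i] i by auto
  thus "lf_root a b c (N - 1) = -1" using i by auto
qed

lemma lf_beta_less_top:
  assumes "a 0 \<noteq> 1"
  shows "lf_beta N a b c < \<infinity>"
  unfolding lf_beta_def using assms by (subst Max_less_iff) auto

lemma lf_fixpoint_in_Y:
  assumes "lf_system N a b c" "N \<ge> 2" "i < N"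
  shows "lf_fixpoint a b c i \<in> lf_Y N a b c"
proof -
  have "ereal (lf_alpha N a b c) \<le> lf_fixpoint a b c i"
  proof (cases "i = 0 \<and> a 0 = 1")
    case False
    then obtain z where z: "lf_fixpoint a b c i = ereal z" "i = 0 \<Longrightarrow> z = c 0 / (1 - a 0)"
      "i \<noteq> 0 \<Longrightarrow> z = lf_root a b c i" by (cases "i = 0") (auto simp: lf_fixpoint_def)
    have "lf_alpha N a b c \<le> z"
      unfolding lf_alpha_def using False z assms(3) by (intro Min_le) (cases "i = 0"; auto)+
    thus ?thesis using z by simp
  qed (simp add: lf_fixpoint_def)
  moreover have "lf_fixpoint a b c i \<le> lf_beta N a b c"
    unfolding lf_beta_def using assms(3)
    by (intro Max_ge) (cases "i = 0"; auto simp: lf_fixpoint_def)+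
  ultimately show ?thesis by (simp add: lf_Y_def)
qed

lemma lf_H_fixed_iff:
  assumes "lf_system N a b c" "N \<ge> 2" "i < N" "y \<in> lf_Y N a b c"
  shows "lf_H a b c i y = y \<longleftrightarrow> y = lf_fixpoint a b c i"
proof (cases y)
  case MInf
  thus ?thesis using assms(4) by (simp add: lf_Y_def)
next
  case PInf
  have "a 0 = 1" using lf_beta_less_top[of a N b c] assms(4) PInf by (auto simp: lf_Y_def)
  thus ?thesis using PInf by (simp add: lf_H_def lf_fixpoint_def)
next
  case (real t)
  have t: "lf_alpha N a b c \<le> t" using assms(4) real by (simp add: lf_Y_def)
  hence t1: "-1 \<le> t" using lf_alpha_bounds(1)[OF assms(1,2)] by simp
  have b0: "b 0 = 0" using assms(1) by (simp add: lf_system_def)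
  show ?thesis
  proof (cases "i = 0")
    case True
    have "lf_H a b c i y = y \<longleftrightarrow> a 0 * t + c 0 = t" using real True b0 by (simp add: lf_H_def)
    also have "\<dots> \<longleftrightarrow> y = lf_fixpoint a b c i"
      using real True lf_zero_less(4)[OF assms(1,2)]
      by (auto simp: lf_fixpoint_def field_simps)
    finally show ?thesis .
  next
    case False
    hence i: "0 < i" by simp
    note bb = lf_b_bounds[OF assms(1,3) i]
    have "b i * (-1) \<le> b i * t" using bb t1 by (intro mult_left_mono) auto
    hence den: "b i * t + 1 > 0" using bb by simp
    have "lf_H a b c i y = y \<longleftrightarrow> (a i * t + c i) / (b i * t + 1) = t"
      using real by (simp add: lf_H_def)
    also have "\<dots> \<longleftrightarrow> b i * t\<^sup>2 + (1 - a i) * t - c i = 0"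
      using den by (auto simp: field_simps power2_eq_square)
    also have "\<dots> \<longleftrightarrow> t = lf_root a b c i"
      using lf_root_props(1)[OF assms(1-3) i] lf_root_props(2)[OF assms(1-3) i, of t] t1 t
        lf_alpha_bounds[OF assms(1,2)] by fastforce
    also have "\<dots> \<longleftrightarrow> y = lf_fixpoint a b c i" using real False by (simp add: lf_fixpoint_def)
    finally show ?thesis .
  qed
qed

lemma lf_Fix_eq:
  assumes "lf_system N a b c" "N \<ge> 2" "i < N"
  shows "lf_Fix N a b c i = lf_fixpoint a b c i"
  unfolding lf_Fix_def
  using lf_H_fixed_iff[OF assms] lf_fixpoint_in_Y[OF assms] by (intro the_equality) blast+

lemma conjugacy_solution_endpoints:
  assumes "lf_system N a b c" "N \<ge> 2" "compatible_system N f"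
    and "conjugacy_solution N f (lf_map a b c) \<phi>"
  shows "\<phi> 0 = 0" "\<phi> 1 = 1"
proof -
  have f: "f 0 0 = 0" "f (N - 1) 1 = 1" using assms(3) by (auto simp: compatible_system_def)
  have b0: "b 0 = 0" "b N = 1" using assms(1) by (auto simp: lf_system_def)
  have less: "\<phi> 0 < \<phi> 1"
    using assms(4) by (auto simp: conjugacy_solution_def strict_mono_on_def)
  have rng: "\<phi> 0 \<in> {0..1}" "\<phi> 1 \<in> {0..1}" using assms(4) by (auto simp: conjugacy_solution_def)
  have pos: "C * y + 1 > 0" if "C + 1 > 0" "y \<in> {0..1}" for C y :: real
  proof (cases "y = 1")
    case False
    hence "0 < 1 - y" "0 \<le> y * (C + 1)" using that by auto
    thus ?thesis by (simp add: algebra_simps)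
  qed (use that in simp)
  show "\<phi> 0 = 0"
  proof (rule ccontr)
    assume ne: "\<phi> 0 \<noteq> 0"
    let ?y = "\<phi> 0"
    have "lf_map a b c 0 (\<phi> 0) = \<phi> 0"
      using assms(2,4) f(1) by (auto simp: conjugacy_solution_def)
    hence "a 0 * ?y = ?y * (c 0 * ?y + 1)"
      using pos[of "c 0" ?y] lf_systemD(1)[OF assms(1), of 0] assms(2) rng b0
      by (simp add: lf_map_def field_simps)
    hence e: "a 0 = c 0 * ?y + 1" using ne by simp
    have "?y * a 0 < ?y * (c 0 + 1)"
      using lf_zero_less(3)[OF assms(1,2)] ne rng by (intro mult_strict_left_mono) auto
    moreover have "(1 - ?y) * a 0 \<le> (1 - ?y) * 1"
      using lf_zero_less(2)[OF assms(1,2)] rng by (intro mult_left_mono) auto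
    ultimately show False using e by (simp add: algebra_simps)
  qed
  show "\<phi> 1 = 1"
  proof (rule ccontr)
    assume ne: "\<phi> 1 \<noteq> 1"
    let ?y = "\<phi> 1" and ?i = "N - 1"
    have i: "?i < N" "0 < ?i" "Suc ?i = N" using assms(2) by auto
    note d = lf_systemD[OF assms(1) i(1)]
    have "lf_map a b c ?i ?y = ?y"
      using i f(2) assms(4) by (auto simp: conjugacy_solution_def)
    hence e: "a ?i * ?y + b ?i = ?y * (c ?i * ?y + 1)"
      using pos[of "c ?i" ?y] d(1) rng by (simp add: lf_map_def field_simps)
    have a: "a ?i = c ?i + 1 - b ?i" using d(5) i b0 by simp
    have "(y - 1) * (C * y + B) = 0" if "(C + 1 - B) * y + B = y * (C * y + 1)" for y C B :: real
      using that by algebra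
    hence "(?y - 1) * (c ?i * ?y + b ?i) = 0" using e unfolding a by blast
    hence z: "c ?i * ?y + b ?i = 0" using ne by simp
    have "(1 - b ?i) * (c ?i + 1) \<le> (c ?i + 1) * (c ?i + 1)"
      using d(4) unfolding a by (simp add: algebra_simps power2_eq_square)
    hence "- b ?i \<le> c ?i" using d(1) by simp
    hence "- b ?i * ?y \<le> c ?i * ?y" using rng by (intro mult_right_mono) auto
    moreover have "0 < b ?i * (1 - ?y)"
      using lf_b_bounds[OF assms(1) i(1,2)] rng ne by (intro mult_pos_pos) auto
    ultimately show False using z by (simp add: algebra_simps)
  qed
qed

lemma dist_measure_characterization:
  fixes \<phi> :: "real \<Rightarrow> real"
  assumes "continuous_on {0..1} \<phi>" "mono_on {0..1} \<phi>" "\<phi> 0 = 0" "\<phi> 1 = 1"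
  shows "prob_space (dist_measure \<phi>)"
    and "sets (dist_measure \<phi>) = sets (restrict_space borel {0..1})"
    and "x \<in> {0..1} \<Longrightarrow> measure (dist_measure \<phi>) {0..x} = \<phi> x"
proof -
  define F where "F = (\<lambda>x::real. if x < 0 then 0 else if x \<le> 1 then \<phi> x else 1)"
  have F_eq: "F = (\<lambda>x. \<phi> (max 0 (min 1 x)))"
    using assms(3,4) by (auto simp: F_def fun_eq_iff max_def min_def)
  have cont: "continuous_on UNIV F"
    unfolding F_eq
    by (rule continuous_on_compose2[OF assms(1)]) (auto intro!: continuous_intros)
  have mono: "F x \<le> F y" if "x \<le> y" for x y
    unfolding F_eq using that by (intro mono_onD[OF assms(2)]) auto
  have nonneg: "0 \<le> F x" for x using mono[of "min x (-1)" x] by (auto simp: F_def)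
  have rcont: "continuous (at_right x) F" for x
    using cont by (metis continuous_on_eq_continuous_at continuous_at_imp_continuous_at_within open_UNIV UNIV_I)
  have em: "emeasure (interval_measure F) {0..x} = ennreal (F x)" if "0 \<le> x" for x
  proof -
    have "emeasure (interval_measure F) {0..x} = ennreal (F x - F 0)"
      using that mono cont by (intro emeasure_interval_measure_Icc) auto
    thus ?thesis using assms(3) by (simp add: F_def)
  qed
  have dm: "dist_measure \<phi> = restrict_space (interval_measure F) {0..1}"
    by (simp add: dist_measure_def F_def)
  show "sets (dist_measure \<phi>) = sets (restrict_space borel {0..1})"
    unfolding dm by (intro sets_restrict_space_cong) simp
  have em': "emeasure (dist_measure \<phi>) {0..x} = ennreal (\<phi> x)" if "x \<in> {0..1}" for x
    unfolding dm using that em[of x] by (subst emeasure_restrict_space) (auto simp: F_def)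
  have sp: "space (dist_measure \<phi>) = {0..1}" unfolding dm by (simp add: space_restrict_space)
  show "prob_space (dist_measure \<phi>)"
    by (rule prob_spaceI) (use em'[of 1] sp assms(4) in simp)
  assume x: "x \<in> {0..1}"
  hence "0 \<le> \<phi> x" using nonneg[of x] by (auto simp: F_def)
  thus "measure (dist_measure \<phi>) {0..x} = \<phi> x" using em'[OF x] by (simp add: measure_def)
qed

end

theory Submission
  imports Defs "HOL-Library.Nat_Bijection"
begin

text \<open>Since $G_0$ is injective, equality of the vectors $\mathfrak p_i$ forces all the maps $H_i$ to have
  the same fixed point $t$, which is finite and larger than $-1$ (\<open>common_fixed_point\<close>). Then the
  Moebius map $\psi(x) = (t+1)x/(tx+1)$ conjugates every $g_i$ to an affine map of slope
  $p_i = (\mathfrak p_0)_i$ (\<open>mobius_chart_lf_map\<close>). As $\psi$ is bi-Lipschitz on $[0,1]$, the measure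
  $\mu_\varphi$ gives the cylinder $f_w((0,1])$ of a word $w$ mass at most $L\,p_w$, where
  $p_w = \prod_k p_{w_k}$, while the diameter of that cylinder is at most $r_w = \prod_k r_{w_k}$.

  The classical bound for the dimension is a quotient of an entropy by a Lyapunov exponent. Here it is
  enough to control the Bhattacharyya sum $\sum_i \sqrt{p_i r_i}$. With $R = \sum_i r_i$,
  \[ 2 \sum_i \sqrt{p_i r_i} = 1 + R - \sum_i (\sqrt{p_i} - \sqrt{r_i})^2, \]
  and by the Cauchy--Schwarz inequality the last sum is at least $\epsilon^2/6$ when $R \le 2$ and
  $\|\mathbf r - \mathbf p\|_1 \ge \epsilon$. Hence $\delta = \epsilon^2/6$ makes the
  Bhattacharyya sum smaller than $1$ (\<open>sum_sqrt_mult_less_1\<close>), and by continuity there are $s < 1$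
  and $\tau < 1$ with $\sum_i q_i < \tau$, where $q_i = \sqrt{p_i r_i^s}$.

  Call a word $w$ of length $n$ good if $q_w \le \tau^n p_w$. The bad words of length $n$ have total
  $p$-weight at most $(\sum_i q_i / \tau)^n$, which tends to $0$; so the set of points lying in good
  cylinders of arbitrarily large length has full measure (\<open>good_limsup_full\<close>). For a good word,
  $r_w^s = q_w^2 / p_w \le \tau^{2n} p_w$, so the good cylinders of length at least $m$ cover that set at a
  total cost that vanishes as $m \to \infty$, and its $s$-dimensional Hausdorff measure is zero
  (\<open>hausdorff_measure_good_limsup\<close>).\<close>

section \<open>Linearising the LF system\<close>

text \<open>The Moebius map that fixes $0$ and $1$ and sends $-1/t$ to infinity, used for
  $t > -1$; it is the identity for $t = 0$.\<close>

definition mobius_chart :: "real \<Rightarrow> real \<Rightarrow> real" where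
  "mobius_chart t x = (t + 1) * x / (t * x + 1)"

lemma one_plus_mult_pos:
  fixes t u :: real
  assumes "-1 < t" "0 \<le> u" "u \<le> 1"
  shows "0 < t * u + 1"
proof (cases "u = 0")
  case False
  hence "0 < (t + 1) * u" using assms by (intro mult_pos_pos) auto
  thus ?thesis using assms by (simp add: algebra_simps)
qed simp

lemma mobius_chart_diff:
  assumes "-1 < t" "u \<in> {0..1}" "v \<in> {0..1}"
  shows "mobius_chart t v - mobius_chart t u = (v - u) * (t + 1) / ((t * v + 1) * (t * u + 1))"
proof -
  have "0 < t * u + 1" "0 < t * v + 1" using assms by (auto intro: one_plus_mult_pos)
  thus ?thesis by (simp add: mobius_chart_def diff_frac_eq) (simp add: algebra_simps)
qed

text \<open>The inverse of the chart is Lipschitz; this transfers mass bounds from $\psi \circ \varphi$ back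
  to $\varphi$.\<close>

lemma mobius_chart_expansion:
  assumes "-1 < t" "u \<in> {0..1}" "v \<in> {0..1}" "u \<le> v"
  shows "v - u \<le> (1 + \<bar>t\<bar>)\<^sup>2 / (t + 1) * (mobius_chart t v - mobius_chart t u)"
proof -
  have pos: "0 < t * u + 1" "0 < t * v + 1" using assms by (auto intro: one_plus_mult_pos)
  have "t * x + 1 \<le> 1 + \<bar>t\<bar>" if "x \<in> {0..1}" for x
  proof -
    have "t * x \<le> \<bar>t\<bar> * x" using that by (intro mult_right_mono) auto
    also have "\<dots> \<le> \<bar>t\<bar>" using that by (simp add: mult_left_le)
    finally show ?thesis by simp
  qed
  hence "(t * v + 1) * (t * u + 1) \<le> (1 + \<bar>t\<bar>) * (1 + \<bar>t\<bar>)"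
    using assms pos by (intro mult_mono) auto
  hence "(v - u) * ((t * v + 1) * (t * u + 1)) \<le> (v - u) * (1 + \<bar>t\<bar>)\<^sup>2"
    using assms by (intro mult_left_mono) (auto simp: power2_eq_square)
  thus ?thesis
    using mobius_chart_diff[OF assms(1-3)] pos assms(1) by (simp add: le_divide_eq mult_ac)
qed

lemma lf_b_unit:
  assumes "lf_system N a b c" "i \<le> N"
  shows "b i \<in> {0..1}"
  using lf_b_mono[OF assms(1), of 0 i] lf_b_mono[OF assms(1), of i N] assms
  by (cases "i = 0"; cases "i = N") (auto simp: lf_system_def)

text \<open>Injectivity of $G_0$ on the finite part of $[-1,\infty]$, with \<open>B\<close> in the role of $b_1$.\<close>

lemma lf_G_0_inj:
  assumes "0 < B" "B < (1::real)" "-1 \<le> u" "-1 \<le> v"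
    and "B * (u + 1) / (B * u + 1) = B * (v + 1) / (B * v + 1)"
  shows "u = v"
proof -
  have "0 < B * x + 1" if "-1 \<le> x" for x
    using mult_left_mono[OF that, of B] assms by simp
  hence "0 < B * u + 1" "0 < B * v + 1" using assms by auto
  hence "B * (u + 1) * (B * v + 1) = B * (v + 1) * (B * u + 1)"
    using assms(5) by (simp add: frac_eq_eq)
  hence "B * (1 - B) * (u - v) = 0" by algebra
  thus ?thesis using assms by simp
qed

text \<open>The equation $a_i t + c_i = t (b_i t + 1)$ says that \<open>t\<close> is fixed by $H_i$. The common fixed point
  cannot be $\infty$, because $H_1$ has a finite one, and it is larger than $-1$ because it is fixed by
  $H_0$.\<close>

lemma common_fixed_point:
  assumes "lf_system N a b c" "N \<ge> 2"
    and eq: "\<And>i. i < N \<Longrightarrow> lf_prob N a b c i = lf_prob N a b c 0"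
  obtains t where "-1 < t"
    and "\<And>i. i < N \<Longrightarrow> a i * t + c i = t * (b i * t + 1)"
    and "\<And>i. i < N \<Longrightarrow> lf_prob N a b c 0 i = mobius_chart t (b (Suc i)) - mobius_chart t (b i)"
proof -
  have b0: "b 0 = 0" "b N = 1" using assms(1) by (auto simp: lf_system_def)
  have b1: "0 < b 1" "b 1 < 1" using lf_b_bounds[OF assms(1), of 1] assms(2) by auto
  have G0: "lf_G N b 0 (ereal u) = b 1 * (u + 1) / (b 1 * u + 1)" for u
    using assms(2) b0 by (simp add: lf_G_def)
  have fixG: "lf_G N b 0 (lf_fixpoint a b c i) = lf_G N b 0 (lf_fixpoint a b c 0)" if "i < N" for i
    using fun_cong[OF eq[OF that], of 0] that assms(2) lf_Fix_eq[OF assms(1,2)]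
    by (simp add: lf_prob_def)
  have root_ge: "-1 \<le> lf_root a b c i" if "0 < i" "i < N" for i
    using lf_root_props(3)[OF assms(1,2)] that by auto
  have a0: "a 0 \<noteq> 1"
  proof
    assume "a 0 = 1"
    hence "lf_G N b 0 (ereal (lf_root a b c 1)) = 1"
      using fixG[of 1] assms(2) by (simp add: lf_fixpoint_def lf_G_def)
    moreover have "0 < b 1 * lf_root a b c 1 + 1"
      using mult_left_mono[OF root_ge[of 1], of "b 1"] b1 assms(2) by simp
    ultimately show False unfolding G0 using b1 by (simp add: field_simps)
  qed
  define t where "t = c 0 / (1 - a 0)"
  have t: "-1 < t" unfolding t_def by (rule lf_first_fix_gt[OF assms(1,2) a0])
  have root: "lf_root a b c i = t" if "0 < i" "i < N" for i
  proof (rule lf_G_0_inj[OF b1 root_ge[OF that]])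
    show "-1 \<le> t" using t by simp
    have "lf_fixpoint a b c i = ereal (lf_root a b c i)" "lf_fixpoint a b c 0 = ereal t"
      using that a0 by (simp_all add: lf_fixpoint_def t_def)
    thus "b 1 * (lf_root a b c i + 1) / (b 1 * lf_root a b c i + 1) = b 1 * (t + 1) / (b 1 * t + 1)"
      using fixG[OF that(2)] by (simp only: G0)
  qed
  have fix_eq: "a i * t + c i = t * (b i * t + 1)" if "i < N" for i
  proof (cases "i = 0")
    case True
    thus ?thesis using a0 b0 by (simp add: t_def field_simps)
  next
    case False
    thus ?thesis using lf_root_props(1)[OF assms(1,2) that] root[of i] that
      by (simp add: algebra_simps power2_eq_square)
  qed
  have prob: "lf_prob N a b c 0 i = mobius_chart t (b (Suc i)) - mobius_chart t (b i)"
    if "i < N" for i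
  proof -
    have "lf_prob N a b c 0 i = lf_G N b i (ereal t)"
      using that lf_Fix_eq[OF assms(1,2), of 0] a0 by (simp add: lf_prob_def lf_fixpoint_def t_def)
    also have "\<dots> = (b (Suc i) - b i) * (t + 1) / ((b (Suc i) * t + 1) * (b i * t + 1))"
    proof (cases "i = N - 1")
      case True
      hence "Suc i = N" using that by simp
      thus ?thesis using True b0 t by (simp add: lf_G_def)
    next
      case False
      thus ?thesis by (simp add: lf_G_def)
    qed
    also have "\<dots> = mobius_chart t (b (Suc i)) - mobius_chart t (b i)"
      using mobius_chart_diff[OF t lf_b_unit lf_b_unit, OF assms(1) _ assms(1), of i "Suc i"] that
      by (simp add: mult.commute)
    finally show ?thesis .
  qed
  show ?thesis using that[OF t fix_eq prob] .
qed

text \<open>In the chart at a fixed point of $H_i$ the map $g_i$ becomes affine.\<close>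

lemma mobius_chart_lf_map:
  assumes "lf_system N a b c" "i < N" "-1 < t" "a i * t + c i = t * (b i * t + 1)" "x \<in> {0..1}"
  shows "mobius_chart t (lf_map a b c i x) =
    (mobius_chart t (b (Suc i)) - mobius_chart t (b i)) * mobius_chart t x + mobius_chart t (b i)"
proof -
  note d = lf_systemD[OF assms(1,2)]
  have bi: "b i \<in> {0..1}" "b (Suc i) \<in> {0..1}" using lf_b_unit[OF assms(1)] assms(2) by auto
  have pos: "0 < t * x + 1" "0 < t * b i + 1" "0 < t * b (Suc i) + 1" "0 < t + 1"
    using assms bi by (auto intro: one_plus_mult_pos)
  have cx: "0 < c i * x + 1" using d(1) assms(5) by (intro one_plus_mult_pos) auto
  have chart: "mobius_chart t (lf_map a b c i z) = 
     (a i - b i * t) / (t * b i + 1) * mobius_chart t z + mobius_chart t (b i)"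
    if z: "0 < c i * z + 1" "0 < t * z + 1" for z
  proof -
    have den: "t * (a i * z + b i) + (c i * z + 1) = (t * b i + 1) * (t * z + 1)"
      using assms(4) by algebra
    have "mobius_chart t (lf_map a b c i z) =
        (t + 1) * (a i * z + b i) / (t * (a i * z + b i) + (c i * z + 1))"
    proof -
      have "t * (u / d) + 1 = (t * u + d) / d" if "0 < d" for u d :: real
        using that by (simp add: add_divide_distrib)
      from this[OF z(1)] have "t * ((a i * z + b i) / (c i * z + 1)) + 1 =
          (t * (a i * z + b i) + (c i * z + 1)) / (c i * z + 1)" .
      thus ?thesis using z(1) by (simp add: mobius_chart_def lf_map_def)
    qed
    also have "\<dots> = (t + 1) * (a i * z + b i) / ((t * b i + 1) * (t * z + 1))"
      by (simp only: den)
    also have "\<dots> = (a i - b i * t) / (t * b i + 1) * mobius_chart t z + mobius_chart t (b i)"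
      using pos(2) z(2) unfolding mobius_chart_def
      by (simp add: divide_simps) (simp add: algebra_simps)
    finally show ?thesis .
  qed
  have "lf_map a b c i 1 = b (Suc i)" using assms(1,2) by (simp add: lf_map_def lf_system_def)
  hence "mobius_chart t (b (Suc i)) - mobius_chart t (b i) = (a i - b i * t) / (t * b i + 1)"
    using chart[of 1] d(1) pos(4) by (simp add: mobius_chart_def)
  thus ?thesis using chart[OF cx pos(1)] by simp
qed

section \<open>Words and cylinders\<close>

text \<open>The words of length \<open>n\<close> over the alphabet $\{0,\dots,N-1\}$.\<close>

definition words :: "nat \<Rightarrow> nat \<Rightarrow> nat list set" where
  "words N n = {w. set w \<subseteq> {..<N} \<and> length w = n}"

text \<open>The multiplicative extension of \<open>u\<close> to words.\<close>

definition weight :: "(nat \<Rightarrow> real) \<Rightarrow> nat list \<Rightarrow> real" where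
  "weight u w = prod_list (map u w)"

text \<open>The cylinder of $w = i_1 \cdots i_n$ in a compatible system is the image of $(0,1]$ under
  $f_w = f_{i_1} \circ \dots \circ f_{i_n}$, which is \<^term>\<open>foldr f w\<close>. The half-open form makes the
  mass of a cylinder the increment of the distribution function.\<close>

definition cylinder :: "(nat \<Rightarrow> real \<Rightarrow> real) \<Rightarrow> nat list \<Rightarrow> real set" where
  "cylinder f w = {foldr f w 0<..foldr f w 1}"

lemma weight_simps [simp]: "weight u [] = 1" "weight u (i # w) = u i * weight u w"
  by (simp_all add: weight_def)

lemma finite_words [simp]: "finite (words N n)"
  unfolding words_def by (rule finite_lists_length_eq) simp

lemma words_0: "words N 0 = {[]}"
  by (auto simp: words_def)

lemma words_Suc: "words N (Suc n) = (\<lambda>(i, w). i # w) ` ({..<N} \<times> words N n)"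
  by (auto simp: words_def length_Suc_conv image_iff)

lemma sum_weight_words: "(\<Sum>w\<in>words N n. weight u w) = (\<Sum>i<N. u i) ^ n"
proof (induction n)
  case (Suc n)
  have "(\<Sum>w\<in>words N (Suc n). weight u w) = (\<Sum>(i, w)\<in>{..<N} \<times> words N n. u i * weight u w)"
    unfolding words_Suc by (subst sum.reindex) (auto intro: inj_onI simp: case_prod_unfold)
  also have "\<dots> = (\<Sum>i<N. u i) * (\<Sum>w\<in>words N n. weight u w)"
    by (simp add: sum_product sum.cartesian_product)
  finally show ?case using Suc.IH by simp
qed (simp add: words_0)

lemma weight_nonneg:
  assumes "\<And>i. i < N \<Longrightarrow> 0 \<le> u i" "set w \<subseteq> {..<N}"
  shows "0 \<le> weight u w"
  using assms(2) by (induction w) (auto intro!: mult_nonneg_nonneg assms(1))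

lemma weight_pos:
  assumes "\<And>i. i < N \<Longrightarrow> 0 < u i" "set w \<subseteq> {..<N}"
  shows "0 < weight u w"
  using assms(2) by (induction w) (auto intro!: mult_pos_pos assms(1))

lemma weight_le_power:
  assumes "\<And>i. i < N \<Longrightarrow> 0 \<le> u i \<and> u i \<le> k" "set w \<subseteq> {..<N}"
  shows "weight u w \<le> k ^ length w"
  using assms(2)
proof (induction w)
  case (Cons i w)
  have i: "0 \<le> u i" "u i \<le> k" "set w \<subseteq> {..<N}" using assms(1)[of i] Cons.prems by auto
  hence "u i * weight u w \<le> k * k ^ length w"
    using Cons.IH assms(1) by (intro mult_mono weight_nonneg[of N]) auto
  thus ?case by simp
qed simp

lemma lip_const_bound:
  assumes "contraction h" "x \<in> {0..1}" "y \<in> {0..1}"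
  shows "\<bar>h x - h y\<bar> \<le> lip_const h * \<bar>x - y\<bar>"
proof (cases "x = y")
  case False
  have "ereal (\<bar>h x - h y\<bar> / \<bar>x - y\<bar>) \<le> lip_norm h"
    unfolding lip_norm_def using assms False by (intro SUP_upper2[of "(x, y)"]) auto
  moreover have "lip_norm h < 1" using assms by (simp add: contraction_def)
  ultimately have "\<bar>h x - h y\<bar> / \<bar>x - y\<bar> \<le> lip_const h"
    unfolding lip_const_def by (cases "lip_norm h") auto
  thus ?thesis using False by (simp add: divide_le_eq)
qed simp

lemma compatible_systemD:
  assumes "compatible_system N f" "i < N"
  shows "f i \<in> {0..1} \<rightarrow> {0..1}" "strict_mono_on {0..1} (f i)" "continuous_on {0..1} (f i)"
  using assms by (auto simp: compatible_system_def)

lemma foldr_unit: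
  assumes "compatible_system N f" "set w \<subseteq> {..<N}" "x \<in> {0..1}"
  shows "foldr f w x \<in> {0..1}"
  using assms(2,3)
proof (induction w)
  case (Cons i w)
  hence "i < N" "foldr f w x \<in> {0..1}" by auto
  thus ?case using funcset_mem[OF compatible_systemD(1)[OF assms(1), of i]] by simp
qed simp

lemma foldr_less:
  assumes "compatible_system N f" "set w \<subseteq> {..<N}"
  shows "foldr f w 0 < foldr f w 1"
  using assms(2)
proof (induction w)
  case (Cons i w)
  hence i: "i < N" "set w \<subseteq> {..<N}" "foldr f w 0 < foldr f w 1" by auto
  have "f i (foldr f w 0) < f i (foldr f w 1)"
    using foldr_unit[OF assms(1) i(2)] i(3)
    by (intro strict_mono_onD[OF compatible_systemD(2)[OF assms(1) i(1)]]) auto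
  thus ?case by simp
qed simp

lemma diameter_cylinder:
  assumes "contractive_system N f" "set w \<subseteq> {..<N}"
    and "\<And>i. i < N \<Longrightarrow> 0 \<le> lip_const (f i)"
  shows "diameter (cylinder f w) \<le> weight (\<lambda>i. lip_const (f i)) w"
proof -
  have comp: "compatible_system N f" using assms(1) by (simp add: contractive_system_def)
  have "foldr f w 1 - foldr f w 0 \<le> weight (\<lambda>i. lip_const (f i)) w"
    using assms(2)
  proof (induction w)
    case (Cons i w)
    let ?u = "foldr f w 0" and ?v = "foldr f w 1"
    have i: "i < N" "set w \<subseteq> {..<N}" using Cons.prems by auto
    have "\<bar>f i ?v - f i ?u\<bar> \<le> lip_const (f i) * \<bar>?v - ?u\<bar>"
      using i assms(1) foldr_unit[OF comp i(2)]
      by (intro lip_const_bound) (auto simp: contractive_system_def)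
    also have "\<dots> \<le> lip_const (f i) * weight (\<lambda>i. lip_const (f i)) w"
      using Cons.IH[OF i(2)] foldr_less[OF comp i(2)] assms(3)[OF i(1)]
      by (intro mult_left_mono) auto
    finally show ?case by simp
  qed simp
  moreover have "diameter (cylinder f w) \<le> diameter {foldr f w 0..foldr f w 1}"
    unfolding cylinder_def by (intro diameter_subset) auto
  ultimately show ?thesis using foldr_less[OF comp assms(2)] by simp
qed

lemma compatible_system_cover:
  assumes "compatible_system N f" "N \<ge> 1" "x \<in> {0<..1}"
  obtains i where "i < N" "f i 0 < x" "x \<le> f i 1"
proof -
  define i where "i = (LEAST i. x \<le> f i 1)"
  have last: "x \<le> f (N - 1) 1" using assms by (simp add: compatible_system_def)
  have le: "x \<le> f i 1" unfolding i_def using last by (rule LeastI)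
  have "i \<le> N - 1" unfolding i_def using last by (rule Least_le)
  hence i: "i < N" using assms(2) by simp
  have "f i 0 < x"
  proof (cases "i = 0")
    case True
    thus ?thesis using assms(1,3) by (simp add: compatible_system_def)
  next
    case False
    hence "f (i - 1) 1 = f i 0" using assms(1) i by (simp add: compatible_system_def)
    moreover have "f (i - 1) 1 < x"
      using not_less_Least[of "i - 1" "\<lambda>i. x \<le> f i 1"] False by (simp add: i_def)
    ultimately show ?thesis by simp
  qed
  thus ?thesis using that i le by blast
qed

lemma cylinders_cover:
  assumes "compatible_system N f" "N \<ge> 1"
  shows "{0<..1} \<subseteq> (\<Union>w\<in>words N n. cylinder f w)"
proof (induction n)
  case 0
  show ?case by (auto simp: words_0 cylinder_def)
next
  case (Suc n)
  show ?case
  proof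
    fix x :: real assume "x \<in> {0<..1}"
    then obtain i where i: "i < N" "f i 0 < x" "x \<le> f i 1"
      by (rule compatible_system_cover[OF assms])
    note fi = compatible_systemD[OF assms(1) i(1)]
    obtain y where y: "0 \<le> y" "y \<le> 1" "f i y = x"
      using IVT'[of "f i" 0 x 1] i fi(3) by auto
    have "y \<in> {0<..1}" using y i by (cases "y = 0") auto
    then obtain w where w: "w \<in> words N n" "foldr f w 0 < y" "y \<le> foldr f w 1"
      using Suc.IH by (auto simp: cylinder_def)
    have un: "foldr f w 0 \<in> {0..1}" "foldr f w 1 \<in> {0..1}"
      using w(1) foldr_unit[OF assms(1)] by (auto simp: words_def)
    have "f i (foldr f w 0) < f i y"
      using w un y by (intro strict_mono_onD[OF fi(2)]) auto
    moreover have "f i y \<le> f i (foldr f w 1)"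
      using w un y by (intro mono_onD[OF strict_mono_on_imp_mono_on[OF fi(2)]]) auto
    ultimately have "x \<in> cylinder f (i # w)" using y by (simp add: cylinder_def)
    moreover have "i # w \<in> words N (Suc n)" using i w(1) by (auto simp: words_def)
    ultimately show "x \<in> (\<Union>w\<in>words N (Suc n). cylinder f w)" by blast
  qed
qed

section \<open>Hausdorff dimension of limsup sets of cylinders\<close>

text \<open>A word is good if its \<open>q\<close>-weight is small in comparison with its \<open>p\<close>-weight. In the application
  $q_i = \sqrt{p_i r_i^s}$, so that this is an upper bound for $r_w^s / p_w$.\<close>

definition good :: "(nat \<Rightarrow> real) \<Rightarrow> (nat \<Rightarrow> real) \<Rightarrow> real \<Rightarrow> nat list set" where
  "good p q \<tau> = {w. weight q w \<le> \<tau> ^ length w * weight p w}"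

text \<open>The points that lie in cylinders of good words of arbitrarily large length.\<close>

definition good_limsup ::
  "nat \<Rightarrow> (nat \<Rightarrow> real \<Rightarrow> real) \<Rightarrow> (nat \<Rightarrow> real) \<Rightarrow> (nat \<Rightarrow> real) \<Rightarrow> real \<Rightarrow> real set" where
  "good_limsup N f p q \<tau> = (\<Inter>m. \<Union>n\<in>{m..}. \<Union>w\<in>words N n \<inter> good p q \<tau>. cylinder f w)"

lemma sum_good_le:
  assumes "finite W" "\<And>w. w \<in> W \<Longrightarrow> set w \<subseteq> {..<N} \<and> m \<le> length w"
    and "\<And>i. i < N \<Longrightarrow> 0 \<le> p i" "(\<Sum>i<N. p i) = 1" "0 < \<tau>" "\<tau> < (1::real)"
  shows "(\<Sum>w\<in>W. \<tau> ^ length w * weight p w) \<le> \<tau> ^ m / (1 - \<tau>)"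
proof -
  obtain M where M: "\<And>w. w \<in> W \<Longrightarrow> length w < M"
    using finite_nat_set_iff_bounded[of "length ` W"] assms(1) by auto
  have "(\<Sum>w\<in>W. \<tau> ^ length w * weight p w)
      \<le> (\<Sum>w\<in>(\<Union>n\<in>{m..<M}. words N n). \<tau> ^ length w * weight p w)"
  proof (intro sum_mono2)
    show "W \<subseteq> (\<Union>n\<in>{m..<M}. words N n)" using assms(2) M by (fastforce simp: words_def)
    fix w assume "w \<in> (\<Union>n\<in>{m..<M}. words N n) - W"
    hence "set w \<subseteq> {..<N}" by (auto simp: words_def)
    thus "0 \<le> \<tau> ^ length w * weight p w"
      using assms(3,5) by (intro mult_nonneg_nonneg weight_nonneg[of N]) auto
  qed simp
  also have "\<dots> = (\<Sum>n\<in>{m..<M}. \<Sum>w\<in>words N n. \<tau> ^ length w * weight p w)"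
    by (intro sum.UNION_disjoint) (auto simp: words_def finite_lists_length_eq)
  also have "\<dots> = (\<Sum>n\<in>{m..<M}. \<tau> ^ n * (\<Sum>w\<in>words N n. weight p w))"
    by (intro sum.cong) (auto simp: words_def sum_distrib_left)
  also have "\<dots> = (\<Sum>n\<in>{m..<M}. \<tau> ^ n)" by (simp add: sum_weight_words assms(4))
  also have "\<dots> \<le> \<tau> ^ m / (1 - \<tau>)"
  proof (cases "m < M")
    case True
    hence "(\<Sum>n\<in>{m..<M}. \<tau> ^ n) = (\<tau> ^ m - \<tau> ^ M) / (1 - \<tau>)"
      using sum_gp[of \<tau> m "M - 1"] assms(6) by (cases M) (auto simp: atLeastLessThanSuc_atLeastAtMost)
    thus ?thesis using assms by (simp add: divide_right_mono)
  qed (use assms in simp)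
  finally show ?thesis .
qed

text \<open>In terms of words: $q_w^2 = p_w r_w^s$ for $q_i = \sqrt{p_i r_i^s}$.\<close>

lemma weight_powr:
  assumes "\<And>i. i < N \<Longrightarrow> 0 < r i" "\<And>i. i < N \<Longrightarrow> 0 < p i"
    and "set w \<subseteq> {..<N}"
  shows "weight r w powr s * weight p w = (weight (\<lambda>i. sqrt (p i) * r i powr (s / 2)) w)\<^sup>2"
  using assms(3)
proof (induction w)
  case (Cons i w)
  have i: "0 < r i" "0 < p i" "0 < weight r w" "set w \<subseteq> {..<N}"
    using assms(1,2) Cons.prems weight_pos[of N r] by auto
  have "(r i powr (s / 2))\<^sup>2 = r i powr s" by (simp add: power2_eq_square flip: powr_add)
  thus ?case using Cons.IH[OF i(4)] i by (simp add: powr_mult power_mult_distrib mult_ac)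
qed simp

lemma hausdorff_measure_good_limsup:
  assumes sys: "contractive_system N f"
    and r: "\<And>i. i < N \<Longrightarrow> 0 < lip_const (f i) \<and> lip_const (f i) \<le> k" and k: "0 < k" "k < 1"
    and p: "\<And>i. i < N \<Longrightarrow> 0 < p i" "(\<Sum>i<N. p i) = 1"
    and q: "q = (\<lambda>i. sqrt (p i) * lip_const (f i) powr (s / 2))"
    and \<tau>: "0 < \<tau>" "\<tau> < 1" and s: "0 < s"
  shows "hausdorff_measure s (good_limsup N f p q \<tau>) = 0"
proof -
  define R where "R = weight (\<lambda>i. lip_const (f i))"
  have comp: "compatible_system N f" using sys by (simp add: contractive_system_def)
  have diam: "diameter (cylinder f w) \<le> R w" if "set w \<subseteq> {..<N}" for w
    unfolding R_def using diameter_cylinder[OF sys that] r by (simp add: less_imp_le)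
  have cost: "hausdorff_gauge s (cylinder f w) \<le> ennreal (\<tau> ^ length w * weight p w)"
    if w: "set w \<subseteq> {..<N}" "w \<in> good p q \<tau>" for w
  proof -
    let ?P = "weight p w" and ?T = "\<tau> ^ length w"
    have P: "0 < ?P" using p w by (auto intro: weight_pos)
    have "0 \<le> weight q w" using w p unfolding q by (intro weight_nonneg[of N]) (auto simp: less_imp_le)
    hence "(weight q w)\<^sup>2 \<le> (?T * ?P)\<^sup>2" using w by (intro power_mono) (auto simp: good_def)
    hence "R w powr s * ?P \<le> ?T\<^sup>2 * ?P * ?P"
      using weight_powr[of N "\<lambda>i. lip_const (f i)" p w s] r p w
      by (simp add: R_def q power_mult_distrib power2_eq_square mult_ac)
    hence "R w powr s \<le> ?T\<^sup>2 * ?P" using P by simp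
    \<comment> \<open>The square is not needed: $\tau^n$ is already summable.\<close>
    also have "?T\<^sup>2 \<le> ?T" using \<tau> by (simp add: power2_eq_square mult_left_le power_le_one)
    finally have R: "R w powr s \<le> ?T * ?P" using P by (simp add: mult_right_mono)
    have "diameter (cylinder f w) powr s \<le> R w powr s"
      using diam[OF w(1)] s by (intro powr_mono2 diameter_ge_0) (auto simp: cylinder_def)
    thus ?thesis using R s by (auto simp: hausdorff_gauge_def intro!: ennreal_leI)
  qed
  have pre: "hausdorff_premeasure s d (good_limsup N f p q \<tau>) \<le> ennreal e" if "0 < d" "0 < e" for d e
  proof -
    have "(\<lambda>m. k ^ m) \<longlonglongrightarrow> 0" using k by (intro LIMSEQ_realpow_zero) auto
    hence ev1: "\<forall>\<^sub>F m in sequentially. k ^ m < d" using \<open>0 < d\<close> by (rule order_tendstoD)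
    have "(\<lambda>m. \<tau> ^ m / (1 - \<tau>)) \<longlonglongrightarrow> 0 / (1 - \<tau>)"
      using \<tau> by (intro tendsto_divide LIMSEQ_realpow_zero) auto
    hence "(\<lambda>m. \<tau> ^ m / (1 - \<tau>)) \<longlonglongrightarrow> 0" by simp
    hence "\<forall>\<^sub>F m in sequentially. \<tau> ^ m / (1 - \<tau>) < e" using \<open>0 < e\<close> by (rule order_tendstoD)
    with ev1 have "\<forall>\<^sub>F m in sequentially. k ^ m < d \<and> \<tau> ^ m / (1 - \<tau>) < e"
      by (rule eventually_conj)
    then obtain m where m: "k ^ m < d" "\<tau> ^ m / (1 - \<tau>) < e"
      by (auto simp: eventually_sequentially)
    \<comment> \<open>The cover consists of the good cylinders of length at least \<open>m\<close>, enumerated through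
      the bijection between natural numbers and lists of natural numbers.\<close>
    define W where "W = {w. set w \<subseteq> {..<N} \<and> m \<le> length w \<and> w \<in> good p q \<tau>}"
    define U where "U = (\<lambda>j. if list_decode j \<in> W then cylinder f (list_decode j) else {})"
    have "good_limsup N f p q \<tau> \<subseteq> (\<Union>w\<in>W. cylinder f w)"
      by (auto simp: good_limsup_def W_def words_def)
    also have "\<dots> \<subseteq> (\<Union>j. U j)"
    proof
      fix x assume "x \<in> (\<Union>w\<in>W. cylinder f w)"
      then obtain w where "w \<in> W" "x \<in> cylinder f w" by blast
      hence "x \<in> U (list_encode w)" by (simp add: U_def)
      thus "x \<in> (\<Union>j. U j)" by blast
    qed
    finally have cov: "good_limsup N f p q \<tau> \<subseteq> (\<Union>j. U j)" .
    have small: "bounded (U j) \<and> diameter (U j) \<le> d" for j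
    proof (cases "list_decode j \<in> W")
      case True
      define w where "w = list_decode j"
      have w: "set w \<subseteq> {..<N}" "m \<le> length w" using True by (auto simp: W_def w_def)
      have "R w \<le> k ^ length w" unfolding R_def using r w by (intro weight_le_power[of N]) (auto simp: less_imp_le)
      also have "\<dots> \<le> k ^ m" using k w by (intro power_decreasing) auto
      finally have "diameter (cylinder f w) \<le> d" using diam[OF w(1)] m by simp
      thus ?thesis using True by (simp add: U_def w_def cylinder_def)
    qed (use \<open>0 < d\<close> in \<open>simp add: U_def\<close>)
    have "(\<Sum>j<n. hausdorff_gauge s (U j)) \<le> ennreal e" for n
    proof -
      have "(\<Sum>j<n. hausdorff_gauge s (U j)) =
          (\<Sum>j\<in>{j. j < n \<and> list_decode j \<in> W}. hausdorff_gauge s (cylinder f (list_decode j)))"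
        by (intro sum.mono_neutral_cong_right) (auto simp: U_def hausdorff_gauge_def)
      also have "\<dots> = (\<Sum>w\<in>list_decode ` {j. j < n \<and> list_decode j \<in> W}. hausdorff_gauge s (cylinder f w))"
        by (subst sum.reindex) (auto intro: inj_on_subset[OF inj_list_decode])
      also have "\<dots> \<le> (\<Sum>w\<in>list_decode ` {j. j < n \<and> list_decode j \<in> W}. ennreal (\<tau> ^ length w * weight p w))"
        using cost by (intro sum_mono) (auto simp: W_def)
      also have "\<dots> = ennreal (\<Sum>w\<in>list_decode ` {j. j < n \<and> list_decode j \<in> W}. \<tau> ^ length w * weight p w)"
        using \<tau> p by (intro sum_ennreal) (auto simp: W_def less_imp_le intro!: mult_nonneg_nonneg weight_nonneg[of N])
      also have "\<dots> \<le> ennreal (\<tau> ^ m / (1 - \<tau>))"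
        using \<tau> p by (intro ennreal_leI sum_good_le[of _ N]) (auto simp: W_def less_imp_le)
      also have "\<dots> \<le> ennreal e" using m by (intro ennreal_leI) simp
      finally show ?thesis .
    qed
    hence "(\<Sum>j. hausdorff_gauge s (U j)) \<le> ennreal e" by (intro suminf_le_const summableI)
    thus ?thesis unfolding hausdorff_premeasure_def
      using cov small by (intro INF_lower2[of U]) auto
  qed
  have "hausdorff_premeasure s d (good_limsup N f p q \<tau>) = 0" if "0 < d" for d
  proof -
    have "hausdorff_premeasure s d (good_limsup N f p q \<tau>) \<le> 0"
    proof (rule ennreal_le_epsilon)
      fix e :: real assume "0 < e"
      thus "hausdorff_premeasure s d (good_limsup N f p q \<tau>) \<le> 0 + ennreal e"
        using pre[OF that] by simp
    qed
    thus ?thesis by simp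
  qed
  hence "hausdorff_measure s (good_limsup N f p q \<tau>) \<le> 0"
    unfolding hausdorff_measure_def by (intro SUP_least) simp
  thus ?thesis by simp
qed

section \<open>The limsup set has full measure\<close>

lemma good_limsup_borel: "good_limsup N f p q \<tau> \<in> sets borel"
proof -
  have "(\<Union>w\<in>words N n \<inter> good p q \<tau>. cylinder f w) \<in> sets borel" for n
    by (rule sets.finite_UN) (auto simp: cylinder_def)
  hence "(\<Union>n\<in>{m..}. \<Union>w\<in>words N n \<inter> good p q \<tau>. cylinder f w) \<in> sets borel" for m
    by (intro sets.countable_UN') auto
  thus ?thesis unfolding good_limsup_def by (intro sets.countable_INT'') simp_all
qed

lemma measure_dist_Ioc:
  assumes "continuous_on {0..1} \<phi>" "mono_on {0..1} \<phi>" "\<phi> 0 = 0" "\<phi> 1 = 1"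
    and "u \<in> {0..1}" "v \<in> {0..1}" "u \<le> v"
  shows "measure (dist_measure \<phi>) {u<..v} = \<phi> v - \<phi> u"
proof -
  note ch = dist_measure_characterization[OF assms(1-4)]
  interpret prob_space "dist_measure \<phi>" by (rule ch(1))
  have meas: "{0..x} \<in> events" if "x \<in> {0..1}" for x
    using that unfolding ch(2) by (auto simp: sets_restrict_space_iff)
  have "{u<..v} = {0..v} - {0..u}" using assms by auto
  thus ?thesis using assms meas ch(3) by (simp add: finite_measure_Diff)
qed

text \<open>A Markov inequality: a bad word \<open>w\<close> of length \<open>n\<close> satisfies
  $p_w < q_w / \tau^n$, and the sum of $q_w / \tau^n$ over all words of length \<open>n\<close> is
  $(\sum_i q_i / \tau)^n$.\<close>

lemma good_limsup_full:
  assumes comp: "compatible_system N f" and N: "N \<ge> 1"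
    and \<phi>: "continuous_on {0..1} \<phi>" "mono_on {0..1} \<phi>" "\<phi> 0 = 0" "\<phi> 1 = 1"
    and p: "\<And>i. i < N \<Longrightarrow> 0 < p i" and q: "\<And>i. i < N \<Longrightarrow> 0 \<le> q i"
    and \<tau>: "(\<Sum>i<N. q i) < \<tau>"
    and bound: "0 \<le> L" "\<And>w. set w \<subseteq> {..<N} \<Longrightarrow> \<phi> (foldr f w 1) - \<phi> (foldr f w 0) \<le> L * weight p w"
  shows "good_limsup N f p q \<tau> \<subseteq> {0..1}"
    and "emeasure (dist_measure \<phi>) (good_limsup N f p q \<tau>) = 1"
proof -
  note ch = dist_measure_characterization[OF \<phi>]
  interpret prob_space "dist_measure \<phi>" by (rule ch(1))
  have ev: "X \<in> events \<longleftrightarrow> X \<in> sets borel \<and> X \<subseteq> {0..1}" for X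
    unfolding ch(2) by (auto simp: sets_restrict_space_iff)
  have sp: "space (dist_measure \<phi>) = {0..1}"
    using sets_eq_imp_space_eq[OF ch(2)] by (simp add: space_restrict_space)
  have cyl: "cylinder f w \<in> events" if "set w \<subseteq> {..<N}" for w
    unfolding ev using foldr_unit[OF comp that, of 0] foldr_unit[OF comp that, of 1]
    by (auto simp: cylinder_def)
  have q0: "0 \<le> (\<Sum>i<N. q i)" using q by (intro sum_nonneg) auto
  hence \<tau>0: "0 < \<tau>" using \<tau> by simp
  define \<theta> where "\<theta> = (\<Sum>i<N. q i) / \<tau>"
  have \<theta>: "0 \<le> \<theta>" "\<theta> < 1" using q0 \<tau> \<tau>0 by (auto simp: \<theta>_def)
  define G where "G = (\<lambda>n. \<Union>w\<in>words N n \<inter> good p q \<tau>. cylinder f w)"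
  have G: "G n \<in> events" for n
    unfolding G_def using cyl by (intro sets.finite_UN) (auto simp: words_def finite_lists_length_eq)
  have bad: "measure (dist_measure \<phi>) ({0<..1} - G n) \<le> L * \<theta> ^ n" for n
  proof -
    have "{0<..1} - G n \<subseteq> (\<Union>w\<in>words N n - good p q \<tau>. cylinder f w)"
      using cylinders_cover[OF comp N, of n] by (auto simp: G_def)
    hence "measure (dist_measure \<phi>) ({0<..1} - G n)
        \<le> measure (dist_measure \<phi>) (\<Union>w\<in>words N n - good p q \<tau>. cylinder f w)"
      using cyl by (intro finite_measure_mono sets.finite_UN) (auto simp: words_def finite_lists_length_eq)
    also have "\<dots> \<le> (\<Sum>w\<in>words N n - good p q \<tau>. measure (dist_measure \<phi>) (cylinder f w))"
      using cyl by (intro finite_measure_subadditive_finite) (auto simp: words_def finite_lists_length_eq)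
    also have "\<dots> \<le> (\<Sum>w\<in>words N n - good p q \<tau>. L * (weight q w / \<tau> ^ n))"
    proof (intro sum_mono)
      fix w assume w: "w \<in> words N n - good p q \<tau>"
      hence W: "set w \<subseteq> {..<N}" "length w = n" by (auto simp: words_def)
      have "measure (dist_measure \<phi>) (cylinder f w) = \<phi> (foldr f w 1) - \<phi> (foldr f w 0)"
        unfolding cylinder_def using foldr_unit[OF comp W(1)] foldr_less[OF comp W(1)]
        by (intro measure_dist_Ioc[OF \<phi>]) auto
      also have "\<dots> \<le> L * weight p w" by (rule bound(2)[OF W(1)])
      also have "\<dots> \<le> L * (weight q w / \<tau> ^ n)"
        using w W(2) \<tau>0 bound(1) by (intro mult_left_mono) (auto simp: good_def field_simps)
      finally show "measure (dist_measure \<phi>) (cylinder f w) \<le> L * (weight q w / \<tau> ^ n)" .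
    qed
    also have "\<dots> \<le> (\<Sum>w\<in>words N n. L * (weight q w / \<tau> ^ n))"
      using bound(1) \<tau>0 q
      by (intro sum_mono2)
        (auto simp: words_def finite_lists_length_eq
          intro!: mult_nonneg_nonneg divide_nonneg_nonneg weight_nonneg[of N])
    also have "\<dots> = L * \<theta> ^ n"
      by (simp add: \<theta>_def power_divide flip: sum_weight_words sum_distrib_left sum_divide_distrib)
    finally show ?thesis .
  qed
  \<comment> \<open>The point 0 belongs to no half-open cylinder.\<close>
  have AE0: "AE x in dist_measure \<phi>. x \<noteq> 0"
  proof (rule AE_I[of _ _ "{0}"])
    have "measure (dist_measure \<phi>) {0..0} = 0" using ch(3)[of 0] \<phi>(3) by simp
    thus "emeasure (dist_measure \<phi>) {0} = 0" by (simp add: emeasure_eq_measure)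
  qed (auto simp: ev)
  have AEm: "AE x in dist_measure \<phi>. x \<in> (\<Union>n\<in>{m..}. G n)" for m
  proof -
    let ?B = "{0<..1} - (\<Union>n\<in>{m..}. G n)"
    have B: "?B \<in> events"
      using G by (intro sets.Diff sets.countable_UN') (auto simp: ev)
    have "(\<lambda>n. L * \<theta> ^ n) \<longlonglongrightarrow> L * 0"
      using \<theta> by (intro tendsto_mult LIMSEQ_realpow_zero tendsto_const)
    moreover have "\<forall>\<^sub>F n in sequentially. measure (dist_measure \<phi>) ?B \<le> L * \<theta> ^ n"
      unfolding eventually_sequentially
    proof (intro exI allI impI)
      fix n assume n: "m \<le> n"
      have "measure (dist_measure \<phi>) ?B \<le> measure (dist_measure \<phi>) ({0<..1} - G n)"
        using G n by (intro finite_measure_mono sets.Diff) (auto simp: ev)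
      thus "measure (dist_measure \<phi>) ?B \<le> L * \<theta> ^ n" using bad[of n] by simp
    qed
    ultimately have "measure (dist_measure \<phi>) ?B \<le> L * 0"
      by (intro tendsto_lowerbound) auto
    hence "measure (dist_measure \<phi>) ?B = 0" by (simp add: measure_le_0_iff)
    hence "AE x in dist_measure \<phi>. x \<notin> ?B"
      using B by (intro AE_not_in) (auto simp: null_sets_def emeasure_eq_measure)
    with AE0 AE_space show ?thesis by eventually_elim (auto simp: sp)
  qed
  have eq: "good_limsup N f p q \<tau> = (\<Inter>m. \<Union>n\<in>{m..}. G n)"
    by (simp add: good_limsup_def G_def)
  show sub: "good_limsup N f p q \<tau> \<subseteq> {0..1}" using G unfolding eq ev by blast
  have "AE x in dist_measure \<phi>. x \<in> good_limsup N f p q \<tau>"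
    using AEm unfolding eq by (simp add: AE_all_countable)
  thus "emeasure (dist_measure \<phi>) (good_limsup N f p q \<tau>) = 1"
    using good_limsup_borel[of N f p q \<tau>] sub by (intro emeasure_eq_1_AE) (auto simp: ev)
qed

section \<open>The dimension drop\<close>

text \<open>The sum $S$ of the $(\sqrt{p_i} - \sqrt{r_i})^2$ is $1 + R - 2 \sum_i \sqrt{p_i r_i}$, and
  $\epsilon^2 \le S T$ by Cauchy--Schwarz, where $T$ is the sum of the
  $(\sqrt{p_i} + \sqrt{r_i})^2$ and is at most $2 (1 + R) \le 6$.\<close>

lemma sum_sqrt_mult_less_1:
  fixes p r :: "nat \<Rightarrow> real"
  assumes p: "\<And>i. i < N \<Longrightarrow> 0 \<le> p i" "(\<Sum>i<N. p i) = 1"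
    and r: "\<And>i. i < N \<Longrightarrow> 0 \<le> r i" "(\<Sum>i<N. r i) < 1 + \<epsilon>\<^sup>2 / 6"
    and \<epsilon>: "0 < \<epsilon>" "\<epsilon> \<le> 1" "\<epsilon> \<le> (\<Sum>i<N. \<bar>r i - p i\<bar>)"
  shows "(\<Sum>i<N. sqrt (p i) * sqrt (r i)) < 1"
proof -
  define S where "S = (\<Sum>i<N. (sqrt (p i) - sqrt (r i))\<^sup>2)"
  define T where "T = (\<Sum>i<N. (sqrt (p i) + sqrt (r i))\<^sup>2)"
  define B where "B = (\<Sum>i<N. sqrt (p i) * sqrt (r i))"
  define R where "R = (\<Sum>i<N. r i)"
  have S: "S = 1 + R - 2 * B"
  proof -
    have "S = (\<Sum>i<N. p i + r i - 2 * (sqrt (p i) * sqrt (r i)))"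
      unfolding S_def using p r by (intro sum.cong) (auto simp: power2_diff)
    thus ?thesis by (simp add: p R_def B_def sum.distrib sum_subtractf sum_distrib_left)
  qed
  have T: "T = 1 + R + 2 * B"
  proof -
    have "T = (\<Sum>i<N. p i + r i + 2 * (sqrt (p i) * sqrt (r i)))"
      unfolding T_def using p r by (intro sum.cong) (auto simp: power2_sum)
    thus ?thesis by (simp add: p R_def B_def sum.distrib sum_distrib_left)
  qed
  have S0: "0 \<le> S" unfolding S_def by (intro sum_nonneg) auto
  have "\<epsilon>\<^sup>2 \<le> 1" using \<epsilon> by (simp add: power_le_one)
  hence T6: "T \<le> 6" using S T S0 r(2) by (simp add: R_def)
  have "(\<Sum>i<N. \<bar>r i - p i\<bar>) = (\<Sum>i<N. \<bar>sqrt (p i) - sqrt (r i)\<bar> * (sqrt (p i) + sqrt (r i)))"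
  proof (intro sum.cong refl)
    fix i assume "i \<in> {..<N}"
    hence "r i - p i = - ((sqrt (p i) - sqrt (r i)) * (sqrt (p i) + sqrt (r i)))"
      "0 \<le> sqrt (p i) + sqrt (r i)"
      using p r by (auto simp: algebra_simps)
    thus "\<bar>r i - p i\<bar> = \<bar>sqrt (p i) - sqrt (r i)\<bar> * (sqrt (p i) + sqrt (r i))"
      by (simp add: abs_mult)
  qed
  hence "\<epsilon>\<^sup>2 \<le> (\<Sum>i<N. \<bar>sqrt (p i) - sqrt (r i)\<bar> * (sqrt (p i) + sqrt (r i)))\<^sup>2"
    using \<epsilon> by (intro power_mono) auto
  also have "\<dots> \<le> S * T"
    using Cauchy_Schwarz_ineq_sum[of "\<lambda>i. \<bar>sqrt (p i) - sqrt (r i)\<bar>" "\<lambda>i. sqrt (p i) + sqrt (r i)" "{..<N}"]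
    by (simp add: S_def T_def)
  also have "\<dots> \<le> S * 6" using S0 T6 by (intro mult_left_mono)
  finally have "\<epsilon>\<^sup>2 / 6 \<le> S" by simp
  thus ?thesis using S r(2) by (simp add: R_def B_def)
qed

text \<open>The vector \<open>p\<close> is related to the system only through its Bhattacharyya sum with the Lipschitz
  constants and the bound on the masses of the cylinders; \<open>\<phi>\<close> need not solve any functional equation.\<close>

lemma measure_hausdorff_dim_less_1:
  assumes sys: "contractive_system N f" and N: "N \<ge> 1"
    and r: "\<And>i. i < N \<Longrightarrow> 0 < lip_const (f i) \<and> lip_const (f i) \<le> k" and k: "0 < k" "k < 1"
    and p: "\<And>i. i < N \<Longrightarrow> 0 < p i" "(\<Sum>i<N. p i) = 1"
    and affinity: "(\<Sum>i<N. sqrt (p i) * sqrt (lip_const (f i))) < 1"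
    and \<phi>: "continuous_on {0..1} \<phi>" "mono_on {0..1} \<phi>" "\<phi> 0 = 0" "\<phi> 1 = 1"
    and bound: "0 \<le> L" "\<And>w. set w \<subseteq> {..<N} \<Longrightarrow> \<phi> (foldr f w 1) - \<phi> (foldr f w 0) \<le> L * weight p w"
  shows "measure_hausdorff_dim (dist_measure \<phi>) < 1"
proof -
  define Q where "Q = (\<lambda>s i. sqrt (p i) * lip_const (f i) powr (s / 2))"
  have "((\<lambda>s. \<Sum>i<N. Q s i) \<longlongrightarrow> (\<Sum>i<N. Q 1 i)) (at_left 1)"
    unfolding Q_def using r by (intro tendsto_intros) (auto simp: less_le)
  moreover have "(\<Sum>i<N. Q 1 i) = (\<Sum>i<N. sqrt (p i) * sqrt (lip_const (f i)))"
    unfolding Q_def using r by (intro sum.cong) (auto simp: powr_half_sqrt less_imp_le)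
  ultimately have "\<forall>\<^sub>F s in at_left 1. (\<Sum>i<N. Q s i) < 1"
    using affinity by (auto dest: order_tendstoD)
  moreover have "\<forall>\<^sub>F s::real in at_left 1. 0 < s \<and> s < 1"
    using eventually_at_left_real[of 0 1] by (simp add: greaterThanLessThan_iff)
  ultimately have "\<forall>\<^sub>F s in at_left 1. (\<Sum>i<N. Q s i) < 1 \<and> 0 < s \<and> s < 1"
    by eventually_elim auto
  hence "\<exists>s. (\<Sum>i<N. Q s i) < 1 \<and> 0 < s \<and> s < 1"
    by (rule eventually_happens'[OF trivial_limit_at_left_real])
  then obtain s where s: "(\<Sum>i<N. Q s i) < 1" "0 < s" "s < 1" by blast
  obtain \<tau> where \<tau>: "(\<Sum>i<N. Q s i) < \<tau>" "\<tau> < 1" using dense[OF s(1)] by blast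
  have Q0: "0 \<le> Q s i" if "i < N" for i using p(1)[OF that] by (simp add: Q_def less_imp_le)
  have "0 \<le> (\<Sum>i<N. Q s i)" using Q0 by (intro sum_nonneg) auto
  hence \<tau>0: "0 < \<tau>" using \<tau> by simp
  let ?A = "good_limsup N f p (Q s) \<tau>"
  have comp: "compatible_system N f" using sys by (simp add: contractive_system_def)
  have full: "?A \<subseteq> {0..1}" "emeasure (dist_measure \<phi>) ?A = 1"
    using good_limsup_full[OF comp N \<phi> p(1) Q0 \<tau>(1) bound] by auto
  have "hausdorff_measure s ?A = 0"
    using hausdorff_measure_good_limsup[OF sys r k p _ \<tau>0 \<tau>(2) s(2), of "Q s"] by (simp add: Q_def)
  hence "hausdorff_dim ?A \<le> ennreal s"
    unfolding hausdorff_dim_def using s by (intro INF_lower) auto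
  moreover have "measure_hausdorff_dim (dist_measure \<phi>) \<le> hausdorff_dim ?A"
    unfolding measure_hausdorff_dim_def using full good_limsup_borel[of N f p "Q s" \<tau>]
    by (intro INF_lower) auto
  moreover have "ennreal s < 1" using s by (simp add: ennreal_less_one_iff)
  ultimately show ?thesis by (meson le_less_trans)
qed

text \<open>After the change of coordinate the distribution function is that of a Bernoulli measure: the
  cylinder of \<open>w\<close> carries the fraction $p_w$ of the total mass.\<close>

lemma chart_increment_foldr:
  assumes comp: "compatible_system N f" and lf: "lf_system N a b c" and t: "-1 < t"
    and fixed: "\<And>i. i < N \<Longrightarrow> a i * t + c i = t * (b i * t + 1)"
    and sol: "conjugacy_solution N f (lf_map a b c) \<phi>"
    and p: "\<And>i. i < N \<Longrightarrow> p i = mobius_chart t (b (Suc i)) - mobius_chart t (b i)"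
    and w: "set w \<subseteq> {..<N}"
  shows "mobius_chart t (\<phi> (foldr f w 1)) - mobius_chart t (\<phi> (foldr f w 0)) =
    weight p w * (mobius_chart t (\<phi> 1) - mobius_chart t (\<phi> 0))"
  using w
proof (induction w)
  case (Cons i w)
  have i: "i < N" "set w \<subseteq> {..<N}" using Cons.prems by auto
  have "mobius_chart t (\<phi> (f i x)) = p i * mobius_chart t (\<phi> x) + mobius_chart t (b i)"
    if x: "x \<in> {0..1}" for x
  proof -
    have "\<phi> x \<in> {0..1}" using sol x by (auto simp: conjugacy_solution_def)
    moreover have "\<phi> (f i x) = lf_map a b c i (\<phi> x)"
      using sol i x by (simp add: conjugacy_solution_def)
    ultimately show ?thesis
      using mobius_chart_lf_map[OF lf i(1) t fixed[OF i(1)]] p[OF i(1)] by simp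
  qed
  hence "mobius_chart t (\<phi> (foldr f (i # w) 1)) - mobius_chart t (\<phi> (foldr f (i # w) 0)) =
      p i * (mobius_chart t (\<phi> (foldr f w 1)) - mobius_chart t (\<phi> (foldr f w 0)))"
    using foldr_unit[OF comp i(2)] by (simp add: algebra_simps)
  thus ?case using Cons.IH[OF i(2)] by simp
qed simp

theorem theorem3p3:
  fixes N :: nat and a b c :: "nat \<Rightarrow> real"
  assumes "N \<ge> 2"
    and "lf_system N a b c"
    and "card (lf_prob N a b c ` {..<N}) = 1"
  shows "\<forall>\<epsilon>::real. 0 < \<epsilon> \<and> \<epsilon> < 1 / 2 \<longrightarrow>
    (\<exists>\<delta>::real. \<delta> > 0 \<and>
      (\<forall>f :: nat \<Rightarrow> real \<Rightarrow> real.
         contractive_system N f \<and>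
         (\<Sum>i<N. lip_const (f i)) < 1 + \<delta> \<and>
         (\<forall>i<N. \<epsilon> \<le> lip_const (f i) \<and> lip_const (f i) \<le> 1 - \<epsilon>) \<and>
         (\<Sum>i<N. \<bar>lip_const (f i) - lf_prob N a b c 0 i\<bar>) \<ge> \<epsilon> \<longrightarrow>
         (\<forall>\<phi> :: real \<Rightarrow> real.
            conjugacy_solution N f (lf_map a b c) \<phi> \<longrightarrow>
            measure_hausdorff_dim (dist_measure \<phi>) < 1)))"
proof (intro allI impI, elim conjE)
  fix \<epsilon> :: real assume \<epsilon>: "0 < \<epsilon>" "\<epsilon> < 1 / 2"
  obtain v where v: "lf_prob N a b c ` {..<N} = {v}" using assms(3) by (auto simp: card_1_singleton_iff)
  have "lf_prob N a b c i = v" if "i < N" for i using v that by blast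
  hence eq: "lf_prob N a b c i = lf_prob N a b c 0" if "i < N" for i using that assms(1) by simp
  obtain t where t: "-1 < t"
    and fixed: "\<And>i. i < N \<Longrightarrow> a i * t + c i = t * (b i * t + 1)"
    and prob: "\<And>i. i < N \<Longrightarrow> lf_prob N a b c 0 i = mobius_chart t (b (Suc i)) - mobius_chart t (b i)"
    using common_fixed_point[OF assms(2,1) eq] by blast
  define p where "p = lf_prob N a b c 0"
  have ends: "mobius_chart t 0 = 0" "mobius_chart t 1 = 1" using t by (auto simp: mobius_chart_def)
  have p_pos: "0 < p i" if "i < N" for i
  proof -
    have "b i \<in> {0..1}" "b (Suc i) \<in> {0..1}" using lf_b_unit[OF assms(2)] that by auto
    moreover from this have "0 < (t * b (Suc i) + 1) * (t * b i + 1)"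
      using t by (intro mult_pos_pos one_plus_mult_pos) auto
    ultimately show ?thesis
      using mobius_chart_diff[OF t] prob[OF that] lf_b_less[OF assms(2) that] t
      by (simp add: p_def)
  qed
  have "(\<Sum>i<N. p i) = (\<Sum>i<N. mobius_chart t (b (Suc i)) - mobius_chart t (b i))"
    using prob by (simp add: p_def)
  also have "\<dots> = 1"
    using sum_lessThan_telescope[of "\<lambda>i. mobius_chart t (b i)" N] assms(2) ends
    by (simp add: lf_system_def)
  finally have p_sum: "(\<Sum>i<N. p i) = 1" .
  show "\<exists>\<delta>::real. \<delta> > 0 \<and>
      (\<forall>f :: nat \<Rightarrow> real \<Rightarrow> real.
         contractive_system N f \<and>
         (\<Sum>i<N. lip_const (f i)) < 1 + \<delta> \<and>
         (\<forall>i<N. \<epsilon> \<le> lip_const (f i) \<and> lip_const (f i) \<le> 1 - \<epsilon>) \<and>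
         (\<Sum>i<N. \<bar>lip_const (f i) - lf_prob N a b c 0 i\<bar>) \<ge> \<epsilon> \<longrightarrow>
         (\<forall>\<phi> :: real \<Rightarrow> real.
            conjugacy_solution N f (lf_map a b c) \<phi> \<longrightarrow>
            measure_hausdorff_dim (dist_measure \<phi>) < 1))"
  proof (intro exI[of _ "\<epsilon>\<^sup>2 / 6"] conjI allI impI; (elim conjE)?)
    show "0 < \<epsilon>\<^sup>2 / 6" using \<epsilon> by simp
    fix f :: "nat \<Rightarrow> real \<Rightarrow> real" and \<phi> :: "real \<Rightarrow> real"
    assume sys: "contractive_system N f"
      and R: "(\<Sum>i<N. lip_const (f i)) < 1 + \<epsilon>\<^sup>2 / 6"
      and r: "\<forall>i<N. \<epsilon> \<le> lip_const (f i) \<and> lip_const (f i) \<le> 1 - \<epsilon>"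
      and far: "(\<Sum>i<N. \<bar>lip_const (f i) - lf_prob N a b c 0 i\<bar>) \<ge> \<epsilon>"
      and sol: "conjugacy_solution N f (lf_map a b c) \<phi>"
    have comp: "compatible_system N f" using sys by (simp add: contractive_system_def)
    note e = conjugacy_solution_endpoints[OF assms(2,1) comp sol]
    have \<phi>: "\<phi> \<in> {0..1} \<rightarrow> {0..1}" "continuous_on {0..1} \<phi>" "mono_on {0..1} \<phi>"
      using sol by (auto simp: conjugacy_solution_def intro: strict_mono_on_imp_mono_on)
    define L where "L = (1 + \<bar>t\<bar>)\<^sup>2 / (t + 1)"
    have "0 \<le> L" using t by (simp add: L_def)
    have bound: "\<phi> (foldr f w 1) - \<phi> (foldr f w 0) \<le> L * weight p w" if w: "set w \<subseteq> {..<N}" for w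
    proof -
      have un: "foldr f w 0 \<in> {0..1}" "foldr f w 1 \<in> {0..1}" using foldr_unit[OF comp w] by auto
      have "\<phi> (foldr f w 0) \<le> \<phi> (foldr f w 1)"
        using foldr_less[OF comp w] un by (intro mono_onD[OF \<phi>(3)]) auto
      hence "\<phi> (foldr f w 1) - \<phi> (foldr f w 0) \<le>
          L * (mobius_chart t (\<phi> (foldr f w 1)) - mobius_chart t (\<phi> (foldr f w 0)))"
        unfolding L_def using \<phi>(1) un by (intro mobius_chart_expansion[OF t]) auto
      thus ?thesis
        using chart_increment_foldr[OF comp assms(2) t fixed sol prob w] ends e by (simp add: p_def)
    qed
    have r': "0 < lip_const (f i) \<and> lip_const (f i) \<le> 1 - \<epsilon>" if "i < N" for i
      using r that \<epsilon> by force
    have "(\<Sum>i<N. sqrt (p i) * sqrt (lip_const (f i))) < 1"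
      using sum_sqrt_mult_less_1[OF _ p_sum _ R] p_pos r' \<epsilon> far by (simp add: p_def less_imp_le)
    thus "measure_hausdorff_dim (dist_measure \<phi>) < 1"
      using measure_hausdorff_dim_less_1[OF sys _ r' _ _ p_pos p_sum _ \<phi>(2,3) e \<open>0 \<le> L\<close> bound]
        assms(1) \<epsilon> by simp
  qed
qed

end
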